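(* Let $G$ be a finite non-abelian group which is $m$-centralizer, where $m=|G|/|Z(G)|$, and which is not a $\mathrm{CA}$-group. Then: (1) There exists a normal subgroup $H\unlhd G$ such that $|H|=16|Z(G)|$ and $Z(G)=Z(H)$. (2) If moreover $|G'|=2$, then $m=2^{2s}$ for some integer $s>1$.
   Context: All groups are finite. $Z(G)$ is the center of $G$, $G'$ is the derived subgroup of $G$, $C_G(x)$ is the centralizer of $x$ in $G$, and $\mathrm{Cent}(G)=\{C_G(x): x\in G\}$. A group $G$ is called $n$-centralizer if $|\mathrm{Cent}(G)|=n$. A non-abelian group $G$ is called a $\mathrm{CA}$-group if $C_G(x)$ is abelian for all $x\in G\setminus Z(G)$. *)

theory Defs
  imports "HOL-Algebra.Algebra"
begin

definition center :: "('a, 'b) monoid_scheme \<Rightarrow> 'a set" where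
  "center G = {z \<in> carrier G. \<forall>g \<in> carrier G. z \<otimes>\<^bsub>G\<^esub> g = g \<otimes>\<^bsub>G\<^esub> z}"

definition centralizer :: "('a, 'b) monoid_scheme \<Rightarrow> 'a \<Rightarrow> 'a set" where
  "centralizer G x = {g \<in> carrier G. g \<otimes>\<^bsub>G\<^esub> x = x \<otimes>\<^bsub>G\<^esub> g}"

definition Cent :: "('a, 'b) monoid_scheme \<Rightarrow> 'a set set" where
  "Cent G = {centralizer G x | x. x \<in> carrier G}"

definition n_centralizer :: "nat \<Rightarrow> ('a, 'b) monoid_scheme \<Rightarrow> bool" where
  "n_centralizer n G \<longleftrightarrow> card (Cent G) = n"

definition CA_group :: "('a, 'b) monoid_scheme \<Rightarrow> bool" where
  "CA_group G \<longleftrightarrow> group G \<and> \<not> comm_group G \<and>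
     (\<forall>x \<in> carrier G - center G. comm_group (G\<lparr>carrier := centralizer G x\<rparr>))"

end

theory Submission
  imports Defs
begin

text \<open>
  The map \<open>x \<mapsto> C(x)\<close> is constant on the cosets of the center \<open>Z\<close>, so being \<open>[G : Z]\<close>-centralizer
  means that different cosets have different centralizers. As \<open>C(x) = C(x\<^sup>-\<^sup>1)\<close>, all squares are
  central, and hence so are all commutators: every subgroup containing \<open>Z\<close> is normal. If \<open>C(x)\<close>
  is non-abelian for some non-central \<open>x\<close>, choose non-commuting \<open>y, z \<in> C(x)\<close> and some \<open>t \<notin> C(x)\<close>.
  Adjoining \<open>x, y, z, t\<close> to \<open>Z\<close> one after the other doubles the order each time, and commuting
  with \<open>x\<close>, \<open>y\<close>, \<open>z\<close>, \<open>t\<close> successively pushes an element of the resulting group back down to \<open>Z\<close>.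
  If \<open>|G'| = 2\<close>, the commutator is a nondegenerate alternating form on \<open>G/Z\<close>, and splitting off
  hyperbolic planes shows that \<open>[G : Z]\<close> is a power of \<open>4\<close>.
\<close>

context group
begin

section \<open>Centralizers, the center, and how centralizers behave on cosets of the center\<close>

lemma mult_inv_cancel_left:
  "\<lbrakk>a \<in> carrier G; b \<in> carrier G\<rbrakk> \<Longrightarrow> a \<otimes> (inv a \<otimes> b) = b"
  "\<lbrakk>a \<in> carrier G; b \<in> carrier G\<rbrakk> \<Longrightarrow> inv a \<otimes> (a \<otimes> b) = b"
  by (simp_all flip: m_assoc)

lemma subgroup_centralizer:
  assumes "x \<in> carrier G"
  shows "subgroup (centralizer G x) G"
proof (rule subgroupI)
  fix a assume a: "a \<in> centralizer G x"
  then have ac: "a \<in> carrier G" and ax: "a \<otimes> x = x \<otimes> a" by (auto simp: centralizer_def)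
  have "a \<otimes> (x \<otimes> inv a) = (x \<otimes> a) \<otimes> inv a" using ac assms by (simp add: ax flip: m_assoc)
  also have "\<dots> = a \<otimes> (inv a \<otimes> x)" using ac assms by (simp add: m_assoc mult_inv_cancel_left)
  finally have "inv a \<otimes> x = x \<otimes> inv a" using ac assms by simp
  then show "inv a \<in> centralizer G x" using ac by (simp add: centralizer_def)
next
  fix a b assume "a \<in> centralizer G x" "b \<in> centralizer G x"
  then show "a \<otimes> b \<in> centralizer G x"
    using assms by (simp add: centralizer_def) (metis m_assoc)
qed (use assms in \<open>auto simp: centralizer_def intro: exI[of _ \<one>]\<close>)

lemma center_eq_Inter_centralizer: "center G = (\<Inter>x\<in>carrier G. centralizer G x)"
  by (auto simp: center_def centralizer_def)

lemma subgroup_center: "subgroup (center G) G"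
  unfolding center_eq_Inter_centralizer
  by (rule subgroups_Inter) (auto intro: subgroup_centralizer)

lemma centralizer_sym:
  "\<lbrakk>x \<in> carrier G; y \<in> centralizer G x\<rbrakk> \<Longrightarrow> x \<in> centralizer G y"
  by (simp add: centralizer_def)

lemma centralizer_self: "x \<in> carrier G \<Longrightarrow> x \<in> centralizer G x"
  by (simp add: centralizer_def)

lemma center_subset_centralizer: "x \<in> carrier G \<Longrightarrow> center G \<subseteq> centralizer G x"
  by (auto simp: center_def centralizer_def)

text \<open>Makes the centralizer a function of the coset \<open>center G #> x\<close>, so that
  centralizers can be counted by cosets.\<close>

lemma centralizer_mult_center:
  assumes "z \<in> center G" "x \<in> carrier G"
  shows "centralizer G (z \<otimes> x) = centralizer G x"
proof -
  have z: "z \<in> carrier G" "\<And>g. g \<in> carrier G \<Longrightarrow> z \<otimes> g = g \<otimes> z"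
    using assms by (auto simp: center_def)
  have "g \<otimes> (z \<otimes> x) = (z \<otimes> x) \<otimes> g \<longleftrightarrow> g \<otimes> x = x \<otimes> g" if "g \<in> carrier G" for g
  proof -
    have "g \<otimes> (z \<otimes> x) = z \<otimes> (g \<otimes> x)" "(z \<otimes> x) \<otimes> g = z \<otimes> (x \<otimes> g)"
      using that assms z by (metis m_assoc)+
    then show ?thesis using that assms z by (metis l_cancel m_closed)
  qed
  then show ?thesis by (auto simp: centralizer_def)
qed

lemma centralizer_inv:
  assumes "x \<in> carrier G"
  shows "centralizer G (inv x) = centralizer G x"
proof -
  have "centralizer G y \<subseteq> centralizer G (inv y)" if "y \<in> carrier G" for y
  proof
    fix g assume g: "g \<in> centralizer G y"
    then have gc: "g \<in> carrier G" by (simp add: centralizer_def)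
    have "inv y \<in> centralizer G g"
      using centralizer_sym[OF that g] subgroup_centralizer[OF gc] subgroup.m_inv_closed by metis
    then show "g \<in> centralizer G (inv y)" using centralizer_sym gc by blast
  qed
  from this[of x] this[of "inv x"] assms show ?thesis by auto
qed

section \<open>Consequences of having as many centralizers as cosets of the center\<close>

text \<open>Sending a coset of the center to the centralizer of a representative is a surjection
  onto \<open>Cent G\<close>. Domain and range are finite of the same cardinality, so the map is
  injective.\<close>

lemma centralizer_eq_imp_rcos_eq:
  assumes fin: "finite (carrier G)"
    and card: "card (Cent G) = order G div card (center G)"
    and x: "x \<in> carrier G" and y: "y \<in> carrier G"
    and eq: "centralizer G x = centralizer G y"
  shows "center G #> x = center G #> y"
proof -
  let ?Z = "center G"
  let ?r = "\<lambda>x. ?Z #> x"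
  let ?F = "\<lambda>U. centralizer G (inv_into (carrier G) ?r U)"
  have rc: "rcosets ?Z = ?r ` carrier G" by (auto simp: RCOSETS_def)
  \<comment> \<open>\<open>?F\<close> works with a chosen representative of the coset; the choice
    does not matter, since two representatives differ by a central factor.\<close>
  have F: "?F (?r u) = centralizer G u" if "u \<in> carrier G" for u
  proof -
    define v where "v = inv_into (carrier G) ?r (?r u)"
    have v: "v \<in> carrier G" "?r v = ?r u"
      using that by (auto simp: v_def f_inv_into_f inv_into_into)
    have "v \<in> ?r u"
      using v subgroup_center rcos_self by metis
    then obtain z where "z \<in> ?Z" "v = z \<otimes> u" by (auto simp: r_coset_def)
    then show ?thesis using that centralizer_mult_center by (simp add: v_def[symmetric])
  qed
  \<comment> \<open>Lagrange shows that the division in \<open>card\<close> is exact, so its value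
    is the number of cosets.\<close>
  have "card (rcosets ?Z) * card ?Z = order G"
    using lagrange[OF subgroup_center] .
  moreover have "card ?Z > 0"
    using fin subgroup_center subgroup.finite_imp_card_positive by blast
  ultimately have "card (rcosets ?Z) = card (Cent G)"
    using card by (metis nonzero_mult_div_cancel_right not_gr_zero)
  moreover have "Cent G = ?F ` (rcosets ?Z)"
    unfolding rc image_image Cent_def using F by auto
  moreover have "finite (rcosets ?Z)" using fin rc by simp
  ultimately have "inj_on ?F (rcosets ?Z)" by (simp add: eq_card_imp_inj_on)
  moreover have "?F (?r x) = ?F (?r y)" using F[OF x] F[OF y] eq by simp
  moreover have "?r x \<in> rcosets ?Z" "?r y \<in> rcosets ?Z" using rc x y by auto
  ultimately show ?thesis by (rule inj_onD)
qed

text \<open>The elements \<open>x\<close> and \<open>inv x\<close> have the same centralizer, hence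
  lie in the same coset of the center; their quotient is \<open>x \<otimes> x\<close>.\<close>

lemma square_in_center:
  assumes "finite (carrier G)" "card (Cent G) = order G div card (center G)"
    and x: "x \<in> carrier G"
  shows "x \<otimes> x \<in> center G"
proof -
  have "center G #> x = center G #> inv x"
    by (rule centralizer_eq_imp_rcos_eq[OF assms]) (use x centralizer_inv in simp_all)
  then have "x \<in> center G #> inv x" using rcos_self[OF x subgroup_center] by blast
  then obtain z where z: "z \<in> center G" "x = z \<otimes> inv x" unfolding r_coset_def by blast
  have zc: "z \<in> carrier G" using z(1) by (simp add: center_def)
  have "x \<otimes> x = (z \<otimes> inv x) \<otimes> x" using z(2) by (rule arg_cong)
  also have "\<dots> = z" using x zc by (simp add: m_assoc)
  finally show ?thesis using z(1) by simp
qed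

text \<open>A conjugate \<open>x \<otimes> h \<otimes> inv x\<close> is the square of
  \<open>x \<otimes> h\<close> times \<open>inv h\<close> times the inverse of the square of
  \<open>x\<close>. Both squares are central and so lie in \<open>N\<close>.\<close>

lemma normal_if_squares_in_center:
  assumes sq: "\<And>x. x \<in> carrier G \<Longrightarrow> x \<otimes> x \<in> center G"
    and N: "subgroup N G" "center G \<subseteq> N"
  shows "N \<lhd> G"
proof -
  have "x \<otimes> h \<otimes> inv x \<in> N" if x: "x \<in> carrier G" and h: "h \<in> N" for x h
  proof -
    have hc: "h \<in> carrier G" using h N subgroup.mem_carrier by metis
    define a where "a = inv (x \<otimes> x)"
    have "a \<in> center G" using sq[OF x] subgroup_center by (simp add: a_def subgroup.m_inv_closed)
    have ac: "a \<in> carrier G" using x by (simp add: a_def)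
    have "x \<otimes> a = inv x" using x by (simp add: a_def inv_mult_group mult_inv_cancel_left)
    then have "x \<otimes> h \<otimes> inv x = ((x \<otimes> h) \<otimes> (x \<otimes> h)) \<otimes> (inv h \<otimes> a)"
      using x hc ac by (simp add: m_assoc mult_inv_cancel_left)
    moreover have "(x \<otimes> h) \<otimes> (x \<otimes> h) \<in> N" using sq x hc N by auto
    moreover have "inv h \<otimes> a \<in> N"
      using h \<open>a \<in> center G\<close> N by (auto intro: subgroup.m_closed subgroup.m_inv_closed)
    ultimately show ?thesis using N subgroup.m_closed by metis
  qed
  then show ?thesis using N by (simp add: normal_inv_iff)
qed

section \<open>Adjoining one element to a subgroup\<close>

text \<open>Normality lets \<open>g\<close> move past elements of \<open>N\<close>, and two factors
  \<open>g\<close> merge into an element of \<open>N\<close>; so two cosets already suffice for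
  closure.\<close>

lemma subgroup_adjoin:
  assumes N: "N \<lhd> G" and g: "g \<in> carrier G" "g \<otimes> g \<in> N"
  shows "subgroup (N \<union> (N #> g)) G"
proof -
  interpret N: normal N G by fact
  have cl: "g \<otimes> n \<otimes> inv g \<in> N" if "n \<in> N" for n
    using that g N by (simp add: N.inv_op_closed2)
  have gn: "\<exists>n'\<in>N. g \<otimes> n = n' \<otimes> g" if "n \<in> N" for n
    using cl[OF that] that g by (intro bexI[of _ "g \<otimes> n \<otimes> inv g"]) (simp_all add: m_assoc)
  \<comment> \<open>As \<open>g \<otimes> g\<close> is in \<open>N\<close>, this places
    \<open>inv g\<close> in the coset \<open>N #> g\<close>.\<close>
  have ginv: "inv g = inv (g \<otimes> g) \<otimes> g" using g by (simp add: inv_mult_group m_assoc)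
  show ?thesis
  proof (rule subgroupI)
    show "N \<union> (N #> g) \<subseteq> carrier G" using g by (auto simp: r_coset_def)
    show "N \<union> (N #> g) \<noteq> {}" using N.one_closed by blast
  next
    fix a assume "a \<in> N \<union> (N #> g)"
    then consider "a \<in> N" | n where "n \<in> N" "a = n \<otimes> g" by (auto simp: r_coset_def)
    then show "inv a \<in> N \<union> (N #> g)"
    proof cases
      case 2
      then obtain n' where n': "n' \<in> N" "g \<otimes> inv n = n' \<otimes> g" using gn[of "inv n"] by auto
      have "inv a = inv (g \<otimes> g) \<otimes> (g \<otimes> inv n)"
        using 2 g by (simp add: inv_mult_group m_assoc mult_inv_cancel_left)
      also have "\<dots> = (inv (g \<otimes> g) \<otimes> n') \<otimes> g" using n' g by (simp add: m_assoc)
      finally show ?thesis using n' g by (auto simp: r_coset_def)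
    qed auto
  next
    fix a b assume a: "a \<in> N \<union> (N #> g)" and b: "b \<in> N \<union> (N #> g)"
    have b_cases: "\<exists>n\<in>N. b = n \<or> b = n \<otimes> g" using b by (auto simp: r_coset_def)
    \<comment> \<open>Closure under products is reduced to left multiplication by elements of
      \<open>N\<close> and by \<open>g\<close> itself.\<close>
    have prod: "n \<otimes> b \<in> N \<union> (N #> g)" if "n \<in> N" for n
      using b_cases that g by (auto simp: r_coset_def) (metis N.mem_carrier N.m_closed m_assoc)
    have "g \<otimes> b \<in> N \<union> (N #> g)"
      using b_cases
    proof (elim bexE disjE)
      fix n assume n: "n \<in> N" "b = n"
      then show ?thesis using gn[of n] by (auto simp: r_coset_def)
    next
      fix n assume n: "n \<in> N" "b = n \<otimes> g"
      then obtain n' where "n' \<in> N" "g \<otimes> n = n' \<otimes> g" using gn by auto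
      then have "g \<otimes> b = n' \<otimes> (g \<otimes> g)" using n g by (metis N.mem_carrier m_assoc)
      then show ?thesis using \<open>n' \<in> N\<close> g by auto
    qed
    then have gb: "(\<exists>n\<in>N. g \<otimes> b = n) \<or> (\<exists>n\<in>N. g \<otimes> b = n \<otimes> g)" by (auto simp: r_coset_def)
    have bc: "b \<in> carrier G" using b g by (auto simp: r_coset_def)
    from a consider "a \<in> N" | n where "n \<in> N" "a = n \<otimes> g" by (auto simp: r_coset_def)
    then show "a \<otimes> b \<in> N \<union> (N #> g)"
    proof cases
      case 1 then show ?thesis by (rule prod)
    next
      case 2
      then have "a \<otimes> b = n \<otimes> (g \<otimes> b)" using g bc by (simp add: m_assoc)
      then show ?thesis using gb 2 g
        by (auto simp: r_coset_def) (metis N.mem_carrier N.m_closed m_assoc)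
    qed
  qed
qed

lemma card_adjoin:
  assumes N: "subgroup N G" and fin: "finite N" and g: "g \<in> carrier G" "g \<notin> N"
  shows "card (N \<union> (N #> g)) = 2 * card N"
proof -
  have sub: "N \<subseteq> carrier G" using N subgroup.subset by blast
  have "card (N #> g) = card N"
    using card_rcosets_equal[OF rcosetsI[OF sub g(1)] sub] by simp
  moreover have "N \<inter> (N #> g) = {}"
  proof -
    have "g \<in> N" if "n \<in> N" "n \<otimes> g \<in> N" for n
    proof -
      have "inv n \<otimes> (n \<otimes> g) \<in> N" using that N subgroup.m_closed subgroup.m_inv_closed by metis
      then show ?thesis using that sub g by (simp add: mult_inv_cancel_left subset_iff)
    qed
    then show ?thesis using g by (auto simp: r_coset_def)
  qed
  moreover have "finite (N #> g)" using fin by (simp add: r_coset_def)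
  ultimately show ?thesis using fin by (simp add: card_Un_disjoint)
qed

lemma adjoin_subset:
  "\<lbrakk>subgroup C G; N \<subseteq> C; g \<in> C\<rbrakk> \<Longrightarrow> N \<union> (N #> g) \<subseteq> C"
  by (auto simp: r_coset_def subgroup.m_closed subset_iff)

text \<open>If \<open>w = n \<otimes> g\<close> with \<open>n\<close> and \<open>w\<close> in
  \<open>C\<close>, then \<open>g\<close> would be in \<open>C\<close>. With a centralizer as
  \<open>C\<close>, this strips the last adjoined generator from an element.\<close>

lemma adjoin_Int_subgroup:
  assumes C: "subgroup C G" and "N \<subseteq> C" and g: "g \<in> carrier G" "g \<notin> C"
    and w: "w \<in> N \<union> (N #> g)" "w \<in> C"
  shows "w \<in> N"
proof (rule ccontr)
  assume "w \<notin> N"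
  then obtain n where n: "n \<in> N" "w = n \<otimes> g" using w by (auto simp: r_coset_def)
  have nC: "n \<in> C" using n assms by auto
  have "n \<in> carrier G" using nC C subgroup.mem_carrier by metis
  then have "g = inv n \<otimes> w" using n g by (simp flip: m_assoc)
  then show False using C nC w g by (metis subgroup.m_closed subgroup.m_inv_closed)
qed

section \<open>The normal subgroup of order 16 times that of the center\<close>

text \<open>In the chain from the center through \<open>A\<close>, \<open>B\<close>,
  \<open>C\<close> to \<open>H\<close>, a centralizer separates each group from the next generator:
  that of \<open>t\<close> contains the center but not \<open>x\<close>, that of \<open>z\<close>
  contains \<open>A\<close> but not \<open>y\<close>, that of \<open>y\<close> contains
  \<open>B\<close> but not \<open>z\<close>, and that of \<open>x\<close> contains \<open>C\<close>
  but not \<open>t\<close>. These four facts give both the order and the center of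
  \<open>H\<close>.\<close>

lemma exists_normal_subgroup_same_center:
  assumes fin: "finite (carrier G)"
    and sq: "\<And>x. x \<in> carrier G \<Longrightarrow> x \<otimes> x \<in> center G"
    and x: "x \<in> carrier G" and t: "t \<in> carrier G" "t \<notin> centralizer G x"
    and y: "y \<in> centralizer G x" and z: "z \<in> centralizer G x" "z \<notin> centralizer G y"
  shows "\<exists>H. H \<lhd> G \<and> card H = 16 * card (center G) \<and> center G = center (G\<lparr>carrier := H\<rparr>)"
proof -
  define A where "A = center G \<union> (center G #> x)"
  define B where "B = A \<union> (A #> y)"
  define C where "C = B \<union> (B #> z)"
  define H where "H = C \<union> (C #> t)"
  have yc: "y \<in> carrier G" and zc: "z \<in> carrier G" using y z by (auto simp: centralizer_def)
  note sc = subgroup_centralizer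
  note nrm = normal_if_squares_in_center[OF sq]
  have sub_step: "subgroup (N \<union> (N #> g)) G \<and> center G \<subseteq> N \<union> (N #> g)"
    if "subgroup N G" "center G \<subseteq> N" "g \<in> carrier G" for N g
    using subgroup_adjoin[OF nrm] that sq by blast
  have A: "subgroup A G" "center G \<subseteq> A"
    using sub_step[of "center G" x] subgroup_center x by (auto simp: A_def)
  have B: "subgroup B G" "center G \<subseteq> B" using sub_step[of A y] A yc by (auto simp: B_def)
  have C: "subgroup C G" "center G \<subseteq> C" using sub_step[of B z] B zc by (auto simp: C_def)
  have H: "subgroup H G" "center G \<subseteq> H" using sub_step[of C t] C t by (auto simp: H_def)
  have Zt: "center G \<subseteq> centralizer G t" using t center_subset_centralizer by simp
  have xt: "x \<notin> centralizer G t" using t centralizer_sym by blast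
  have yz: "y \<notin> centralizer G z" using z zc yc centralizer_sym by blast
  have xy: "x \<in> centralizer G y" and xz: "x \<in> centralizer G z"
    using x y z centralizer_sym by auto
  have Az: "A \<subseteq> centralizer G z"
    unfolding A_def using sc zc center_subset_centralizer xz by (intro adjoin_subset) auto
  have Ay: "A \<subseteq> centralizer G y"
    unfolding A_def using sc yc center_subset_centralizer xy by (intro adjoin_subset) auto
  have Ax: "A \<subseteq> centralizer G x"
    unfolding A_def using sc x center_subset_centralizer centralizer_self by (intro adjoin_subset) auto
  have By: "B \<subseteq> centralizer G y"
    unfolding B_def using sc yc Ay centralizer_self by (intro adjoin_subset) auto
  have Bx: "B \<subseteq> centralizer G x"
    unfolding B_def using sc x Ax y by (intro adjoin_subset) auto
  have Cx: "C \<subseteq> centralizer G x"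
    unfolding C_def using sc x Bx z by (intro adjoin_subset) auto
  have finsub: "finite N" if "subgroup N G" for N
    using that fin subgroup.subset finite_subset by metis
  have "card A = 2 * card (center G)"
    unfolding A_def using xt Zt x subgroup_center finsub by (intro card_adjoin) auto
  moreover have "card B = 2 * card A"
    unfolding B_def using yz Az yc A finsub by (intro card_adjoin) auto
  moreover have "card C = 2 * card B"
    unfolding C_def using z By zc B finsub by (intro card_adjoin) auto
  moreover have "card H = 2 * card C"
    unfolding H_def using t Cx C finsub by (intro card_adjoin) auto
  ultimately have card: "card H = 16 * card (center G)" by simp
  have tH: "t \<in> H" using rcos_self[OF t(1) C(1)] by (simp add: H_def)
  have zC: "z \<in> C" using rcos_self[OF zc B(1)] by (simp add: C_def)
  have yB: "y \<in> B" using rcos_self[OF yc A(1)] by (simp add: B_def)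
  have xA: "x \<in> A" using rcos_self[OF x subgroup_center] by (simp add: A_def)
  have gens: "{x, y, z, t} \<subseteq> H" using tH zC yB xA by (auto simp: H_def C_def B_def)
  \<comment> \<open>An element commuting with all of \<open>H\<close> lies in all four separating
    centralizers, so it descends the chain: the generators \<open>t\<close>, \<open>z\<close>,
    \<open>y\<close>, \<open>x\<close> are stripped in this order.\<close>
  have "w \<in> center G" if w: "w \<in> H" "\<And>g. g \<in> H \<Longrightarrow> w \<otimes> g = g \<otimes> w" for w
  proof -
    have "w \<in> carrier G" using w H subgroup.mem_carrier by metis
    then have wc: "w \<in> centralizer G g" if "g \<in> {x, y, z, t}" for g
      using that w gens by (auto simp: centralizer_def)
    have "w \<in> C"
      by (rule adjoin_Int_subgroup[OF sc[OF x] Cx t]) (use w(1) wc in \<open>auto simp: H_def\<close>)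
    then have "w \<in> B"
      by (intro adjoin_Int_subgroup[OF sc[OF yc] By zc z(2)]) (use wc in \<open>auto simp: C_def\<close>)
    then have "w \<in> A"
      by (intro adjoin_Int_subgroup[OF sc[OF zc] Az yc yz]) (use wc in \<open>auto simp: B_def\<close>)
    then show ?thesis
      by (intro adjoin_Int_subgroup[OF sc[OF t(1)] Zt x xt]) (use wc in \<open>auto simp: A_def\<close>)
  qed
  moreover have "center G \<subseteq> {w \<in> H. \<forall>g\<in>H. w \<otimes> g = g \<otimes> w}"
    using H subgroup.mem_carrier by (fastforce simp: center_def)
  ultimately have "center G = center (G\<lparr>carrier := H\<rparr>)"
    unfolding center_def[of "G\<lparr>carrier := H\<rparr>"] by auto
  with card nrm H show ?thesis by blast
qed

section \<open>Orders of subgroups when all commutators are trivial or one central element\<close>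

text \<open>If \<open>h\<close> and \<open>y\<close> both fail to commute with \<open>x\<close>,
  each contributes the same factor \<open>c\<close>, and the two cancel in
  \<open>h \<otimes> inv y\<close>. Thus all elements of \<open>H\<close> outside the centralizer
  form a single coset.\<close>

lemma card_eq_2_mult_card_Int_centralizer:
  assumes c: "c \<in> center G"
    and comm: "\<And>x y. \<lbrakk>x \<in> carrier G; y \<in> carrier G\<rbrakk> \<Longrightarrow> x \<otimes> y = y \<otimes> x \<or> x \<otimes> y = c \<otimes> (y \<otimes> x)"
    and H: "subgroup H G" "finite H"
    and x: "x \<in> carrier G" and y: "y \<in> H" "y \<notin> centralizer G x"
  shows "card H = 2 * card (H \<inter> centralizer G x)"
proof -
  let ?K = "H \<inter> centralizer G x"
  have K: "subgroup ?K G" using H subgroup_centralizer[OF x] subgroups_Inter_pair by blast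
  have yc: "y \<in> carrier G" using y H subgroup.mem_carrier by metis
  have cc: "c \<in> carrier G" "\<And>g. g \<in> carrier G \<Longrightarrow> c \<otimes> g = g \<otimes> c"
    using c by (auto simp: center_def)
  have "h \<in> ?K \<union> (?K #> y)" if h: "h \<in> H" for h
  proof (cases "h \<in> centralizer G x")
    case False
    have hc: "h \<in> carrier G" using h H subgroup.mem_carrier by metis
    have hx: "h \<otimes> x = c \<otimes> (x \<otimes> h)" using comm[OF hc x] False hc by (auto simp: centralizer_def)
    have yx: "y \<otimes> x = c \<otimes> (x \<otimes> y)" using comm[OF yc x] y yc by (auto simp: centralizer_def)
    define k where "k = h \<otimes> inv y"
    have kc: "k \<in> carrier G" using hc yc by (simp add: k_def)
    have hk: "h = k \<otimes> y" using hc yc by (simp add: k_def m_assoc)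
    \<comment> \<open>Both sides of this chain compute \<open>h \<otimes> x\<close>: the first
      \<open>c\<close> comes from moving \<open>y\<close> past \<open>x\<close>, the second from
      moving \<open>h\<close> past \<open>x\<close>.\<close>
    have "c \<otimes> ((k \<otimes> x) \<otimes> y) = k \<otimes> (y \<otimes> x)"
      unfolding yx using cc kc x yc by (metis m_assoc m_closed)
    also have "\<dots> = c \<otimes> ((x \<otimes> k) \<otimes> y)"
      using hx unfolding hk using kc x yc by (simp add: m_assoc)
    finally have "k \<otimes> x = x \<otimes> k" using cc kc x yc by simp
    then have "k \<in> ?K"
      using kc h y H by (simp add: centralizer_def k_def subgroup.m_closed subgroup.m_inv_closed)
    then show ?thesis using hk by (auto simp: r_coset_def)
  qed (use h in blast)
  moreover have "?K \<union> (?K #> y) \<subseteq> H" using H y by (intro adjoin_subset) auto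
  ultimately have "H = ?K \<union> (?K #> y)" by blast
  then show ?thesis using card_adjoin[OF K _ yc] y H by auto
qed

text \<open>A non-commuting pair \<open>x\<close>, \<open>y\<close> spans a hyperbolic plane for the
  commutator form. Its orthogonal complement \<open>K\<close>, the elements of \<open>H\<close>
  commuting with both, has index 4 and the same center as \<open>H\<close>, so induction on the
  order applies.\<close>

lemma card_eq_4_power_mult_card_center:
  assumes c: "c \<in> center G"
    and comm: "\<And>x y. \<lbrakk>x \<in> carrier G; y \<in> carrier G\<rbrakk> \<Longrightarrow> x \<otimes> y = y \<otimes> x \<or> x \<otimes> y = c \<otimes> (y \<otimes> x)"
    and "subgroup H G" "finite H"
  shows "\<exists>s::nat. card H = 4 ^ s * card (center (G\<lparr>carrier := H\<rparr>))"
  using assms(3,4)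
proof (induction "card H" arbitrary: H rule: less_induct)
  case less
  note H = less.prems
  have Hc: "h \<in> carrier G" if "h \<in> H" for h using that H subgroup.mem_carrier by metis
  show ?case
  proof (cases "\<forall>x\<in>H. \<forall>y\<in>H. x \<otimes> y = y \<otimes> x")
    case True
    then have "center (G\<lparr>carrier := H\<rparr>) = H" by (auto simp: center_def)
    then show ?thesis by (metis mult_1 power_0)
  next
    case False
    then obtain x y where xy: "x \<in> H" "y \<in> H" "x \<otimes> y \<noteq> y \<otimes> x" by blast
    define A where "A = H \<inter> centralizer G x"
    define K where "K = A \<inter> centralizer G y"
    have xc: "x \<in> carrier G" and yc: "y \<in> carrier G" using xy Hc by auto
    have A: "subgroup A G" "finite A"
      using H subgroup_centralizer[OF xc] subgroups_Inter_pair by (auto simp: A_def)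
    have K: "subgroup K G" "finite K"
      using A subgroup_centralizer[OF yc] subgroups_Inter_pair by (auto simp: K_def)
    have yCx: "y \<notin> centralizer G x" and xCy: "x \<notin> centralizer G y"
      using xy by (auto simp: centralizer_def)
    have xA: "x \<in> A" using xy xc by (simp add: A_def centralizer_self)
    \<comment> \<open>Two halvings: \<open>y\<close> witnesses the first, and \<open>x\<close>,
      which survives in its own centralizer, the second. \<open>M\<close> is kept general because
      the count serves both for \<open>H\<close> and for the centralizer of an element in
      \<open>H\<close>.\<close>
    have quarter: "card M = 4 * card (M \<inter> centralizer G x \<inter> centralizer G y)"
      if M: "subgroup M G" "finite M" "x \<in> M" "y \<in> M" for M
    proof -
      have "subgroup (M \<inter> centralizer G x) G" "finite (M \<inter> centralizer G x)"
        using M subgroup_centralizer[OF xc] subgroups_Inter_pair by auto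
      moreover have "x \<in> M \<inter> centralizer G x" using M xc by (simp add: centralizer_self)
      ultimately show ?thesis
        using card_eq_2_mult_card_Int_centralizer[OF c comm _ _ yc _ xCy]
          card_eq_2_mult_card_Int_centralizer[OF c comm M(1,2) xc M(4) yCx] by simp
    qed
    have card: "card H = 4 * card K"
      using quarter[OF H xy(1,2)] by (simp add: K_def A_def)
    have "card K > 0" using K subgroup.one_closed card_gt_0_iff by blast
    then obtain s where s: "card K = 4 ^ s * card (center (G\<lparr>carrier := K\<rparr>))"
      using less.hyps[OF _ K] card by auto
    have "center (G\<lparr>carrier := K\<rparr>) = center (G\<lparr>carrier := H\<rparr>)"
    proof
      show "center (G\<lparr>carrier := H\<rparr>) \<subseteq> center (G\<lparr>carrier := K\<rparr>)"
        \<comment> \<open>Since \<open>x\<close> and \<open>y\<close> belong to \<open>H\<close>,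
          whatever is central in \<open>H\<close> commutes with them and so lies in
          \<open>K\<close>.\<close>
        using xy Hc by (auto simp: center_def K_def A_def centralizer_def)
      show "center (G\<lparr>carrier := K\<rparr>) \<subseteq> center (G\<lparr>carrier := H\<rparr>)"
      proof
        fix w assume "w \<in> center (G\<lparr>carrier := K\<rparr>)"
        then have wK: "w \<in> K" and w: "\<And>g. g \<in> K \<Longrightarrow> w \<otimes> g = g \<otimes> w" by (auto simp: center_def)
        have wc: "w \<in> carrier G" using wK K subgroup.mem_carrier by metis
        \<comment> \<open>The subgroup \<open>?L\<close> contains \<open>K\<close>, \<open>x\<close>
          and \<open>y\<close>. By \<open>quarter\<close> its order is four times that of
          \<open>K\<close>, which is that of \<open>H\<close>; hence \<open>w\<close> commutes with
          all of \<open>H\<close>.\<close>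
        let ?L = "H \<inter> centralizer G w"
        have L: "subgroup ?L G"
          using H subgroup_centralizer[OF wc] subgroups_Inter_pair by blast
        have KL: "K \<subseteq> ?L" using w wc Hc by (auto simp: K_def A_def centralizer_def)
        have "x \<in> ?L" "y \<in> ?L" using wK xy xc yc wc by (auto simp: K_def A_def centralizer_def)
        then have "card ?L = 4 * card (?L \<inter> centralizer G x \<inter> centralizer G y)"
          using quarter L H by blast
        moreover have "?L \<inter> centralizer G x \<inter> centralizer G y = K"
          using KL by (auto simp: K_def A_def)
        ultimately have "?L = H" using card H by (intro card_subset_eq) auto
        then have "H \<subseteq> centralizer G w" by blast
        then show "w \<in> center (G\<lparr>carrier := H\<rparr>)"
          using wK by (auto simp: center_def K_def A_def centralizer_def)
      qed
    qed
    then show ?thesis using s card by (intro exI[of _ "Suc s"]) simp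
  qed
qed

end

theorem theorem6:
  fixes G :: "('a, 'b) monoid_scheme" and m :: nat
  assumes "group G" and "finite (carrier G)"
    and "\<not> comm_group G"
    and "m = order G div card (center G)"
    and "n_centralizer m G"
    and "\<not> CA_group G"
  shows "(\<exists>H. H \<lhd> G \<and> card H = 16 * card (center G) \<and> center G = center (G\<lparr>carrier := H\<rparr>))
    \<and> (card (derived G (carrier G)) = 2 \<longrightarrow> (\<exists>s::nat. s > 1 \<and> m = 2 ^ (2 * s)))"
proof -
  interpret group G by fact
  have sq: "x \<otimes>\<^bsub>G\<^esub> x \<in> center G" if "x \<in> carrier G" for x
    using square_in_center[OF assms(2) _ that] assms(4,5) by (simp add: n_centralizer_def)
  obtain x where x: "x \<in> carrier G" "x \<notin> center G"
    and ncomm: "\<not> comm_group (G\<lparr>carrier := centralizer G x\<rparr>)"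
    using assms by (auto simp: CA_group_def)
  obtain t where t: "t \<in> carrier G" "t \<notin> centralizer G x"
    using x by (auto simp: center_def centralizer_def)
  obtain y z where yz: "y \<in> centralizer G x" "z \<in> centralizer G x" "z \<notin> centralizer G y"
  proof -
    \<comment> \<open>The predicate \<open>comm_group\<close> includes the group axioms, so its
      failure gives a non-commuting pair only once the centralizer is known to be a group.\<close>
    have "group (G\<lparr>carrier := centralizer G x\<rparr>)"
      using subgroup_centralizer x by (simp add: subgroup_imp_group)
    then have "\<exists>y\<in>centralizer G x. \<exists>z\<in>centralizer G x. z \<otimes>\<^bsub>G\<^esub> y \<noteq> y \<otimes>\<^bsub>G\<^esub> z"
      using ncomm group.group_comm_groupI by fastforce
    then show ?thesis using that by (auto simp: centralizer_def)
  qed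
  obtain H where H: "H \<lhd> G" "card H = 16 * card (center G)"
      "center G = center (G\<lparr>carrier := H\<rparr>)"
    using exists_normal_subgroup_same_center[OF assms(2) sq x(1) t yz] by blast
  have Zpos: "card (center G) > 0"
    using assms(2) subgroup_center subgroup.finite_imp_card_positive by blast
  have "\<exists>s::nat. s > 1 \<and> m = 2 ^ (2 * s)" if two: "card (derived G (carrier G)) = 2"
  proof -
    let ?D = "derived G (carrier G)"
    have D: "?D \<lhd> G" by (rule derived_self_is_normal)
    have Dsub: "subgroup ?D G" using D by (rule normal_imp_subgroup)
    obtain c where c: "?D = {\<one>\<^bsub>G\<^esub>, c}" "c \<noteq> \<one>\<^bsub>G\<^esub>"
    proof -
      obtain a b where ab: "?D = {a, b}" "a \<noteq> b" using two by (auto simp: card_2_iff)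
      then consider "a = \<one>\<^bsub>G\<^esub>" | "b = \<one>\<^bsub>G\<^esub>" using subgroup.one_closed[OF Dsub] by auto
      then show ?thesis
      proof cases
        case 1 then show ?thesis using ab that[of b] by simp
      next
        case 2 then show ?thesis using ab that[of a] by (simp add: insert_commute)
      qed
    qed
    have cc: "c \<in> carrier G" using c subgroup.mem_carrier[OF Dsub, of c] by simp
    \<comment> \<open>Conjugation maps the normal subgroup with elements \<open>\<one>\<close> and
      \<open>c\<close> to itself and sends only \<open>\<one>\<close> to \<open>\<one>\<close>, so
      it fixes \<open>c\<close>.\<close>
    have "g \<otimes>\<^bsub>G\<^esub> c = c \<otimes>\<^bsub>G\<^esub> g" if g: "g \<in> carrier G" for g
    proof -
      have "g \<otimes>\<^bsub>G\<^esub> c \<otimes>\<^bsub>G\<^esub> inv\<^bsub>G\<^esub> g \<in> ?D" using D g c by (auto simp: normal_inv_iff)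
      moreover have "g \<otimes>\<^bsub>G\<^esub> c \<otimes>\<^bsub>G\<^esub> inv\<^bsub>G\<^esub> g \<noteq> \<one>\<^bsub>G\<^esub>"
        using c(2) cc g by (subst inv_solve_right') auto
      ultimately have "g \<otimes>\<^bsub>G\<^esub> c \<otimes>\<^bsub>G\<^esub> inv\<^bsub>G\<^esub> g = c" using c by auto
      then show ?thesis using g cc by (subst (asm) inv_solve_right') auto
    qed
    then have cZ: "c \<in> center G" using cc by (simp add: center_def)
    have comm: "a \<otimes>\<^bsub>G\<^esub> b = b \<otimes>\<^bsub>G\<^esub> a \<or> a \<otimes>\<^bsub>G\<^esub> b = c \<otimes>\<^bsub>G\<^esub> (b \<otimes>\<^bsub>G\<^esub> a)"
      if "a \<in> carrier G" "b \<in> carrier G" for a b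
    proof -
      define k where "k = a \<otimes>\<^bsub>G\<^esub> b \<otimes>\<^bsub>G\<^esub> inv\<^bsub>G\<^esub> a \<otimes>\<^bsub>G\<^esub> inv\<^bsub>G\<^esub> b"
      have "k \<in> ?D"
        unfolding derived_def k_def using that by (intro generate.incl) auto
      moreover have "a \<otimes>\<^bsub>G\<^esub> b = k \<otimes>\<^bsub>G\<^esub> (b \<otimes>\<^bsub>G\<^esub> a)"
        using that by (simp add: k_def m_assoc inv_solve_left) (simp flip: m_assoc)
      ultimately show ?thesis using c that by auto
    qed
    obtain s :: nat where s: "order G = 4 ^ s * card (center G)"
      using card_eq_4_power_mult_card_center[OF cZ comm subgroup_self assms(2)]
      by (auto simp: order_def)
    then have m: "m = 4 ^ s" using Zpos assms(4) by simp
    \<comment> \<open>The bound on \<open>s\<close> comes from the first claim: a subgroup of order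
      16 times that of the center fits into \<open>G\<close>, so \<open>4 ^ s\<close> is at least
      16.\<close>
    have "card H \<le> order G"
      unfolding order_def using H(1) assms(2) normal_imp_subgroup subgroup.subset card_mono by metis
    then have "(4::nat) ^ 2 \<le> 4 ^ s" using H(2) s Zpos by simp
    then have "s > 1" by (subst (asm) power_increasing_iff) auto
    then show ?thesis using m by (auto simp: power_mult)
  qed
  with H show ?thesis by blast
qed

end
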